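(* Let $p\in(0,1)$ and let $k$ be a fixed positive integer. For each $n$ let $G=G_n$ and $H=H_n$ be independent Erdős–Rényi graphs $G(n,p)$, and let $u\in V(G)$, $v\in V(H)$ be fixed vertices (e.g. $u=v=1$). Then $$C_k^{G\times H}((u,v))\to p^{2\binom{k}{2}}\quad\text{as } n\to\infty,$$ with probability one.
   Context: An Erdős–Rényi graph $G(n,p)$ is a random simple graph on $\{1,\dots,n\}$ with each edge present independently with probability $p$; for almost sure statements $G_n$ (resp. $H_n$) is realized as the subgraph induced on $\{1,\dots,n\}$ of a random graph on $\mathbb{N}$ with independent edges of probability $p$, the two infinite random graphs being independent. The tensor product $G\times H$ has vertex set $V(G)\times V(H)$, with $(v_1,v_2)$ adjacent to $(v_1',v_2')$ iff $v_1v_1'\in E(G)$ and $v_2v_2'\in E(H)$. For a graph $F$ and vertex $w$, $N(w)$ is the set of neighbours of $w$ ($w\notin N(w)$), $d^F(w)=|N(w)|$, $A_k^F(w)$ is the number of $k$-cliques (sets of $k$ pairwise adjacent vertices) in $N(w)$, and $C_k^F(w)=A_k^F(w)/\binom{d^F(w)}{k}$ (defined when $d^F(w)\ge k$). *)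

theory Defs
  imports "HOL-Probability.Probability"
begin

section \<open>Simple graphs, tensor products and clustering coefficients\<close>

record 'a sgraph =
  verts :: "'a set"
  edges :: "'a set set"

definition simple_graph :: "'a sgraph \<Rightarrow> bool" where
  "simple_graph F \<longleftrightarrow> (\<forall>e\<in>edges F. e \<subseteq> verts F \<and> card e = 2)"

definition adj :: "'a sgraph \<Rightarrow> 'a \<Rightarrow> 'a \<Rightarrow> bool" where
  "adj F x y \<longleftrightarrow> {x, y} \<in> edges F"

definition induced :: "'a sgraph \<Rightarrow> 'a set \<Rightarrow> 'a sgraph" where
  "induced F S = \<lparr>verts = verts F \<inter> S, edges = {e \<in> edges F. e \<subseteq> S}\<rparr>"

definition tensor :: "'a sgraph \<Rightarrow> 'b sgraph \<Rightarrow> ('a \<times> 'b) sgraph" where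
  "tensor F K = \<lparr>verts = verts F \<times> verts K,
     edges = {{(x, y), (x', y')} | x y x' y'. adj F x x' \<and> adj K y y'}\<rparr>"

definition nbrs :: "'a sgraph \<Rightarrow> 'a \<Rightarrow> 'a set" where
  "nbrs F w = {x \<in> verts F. adj F w x}"

definition degree :: "'a sgraph \<Rightarrow> 'a \<Rightarrow> nat" where
  "degree F w = card (nbrs F w)"

definition nbr_cliques :: "nat \<Rightarrow> 'a sgraph \<Rightarrow> 'a \<Rightarrow> nat" where
  "nbr_cliques k F w = card {S. S \<subseteq> nbrs F w \<and> finite S \<and> card S = k \<and> pairwise (adj F) S}"

text \<open>
  The quotient is only meaningful if \<open>k \<le> degree F w\<close>; otherwise the binomial coefficient
  vanishes and the value is \<open>0\<close> by the convention \<open>x / 0 = 0\<close>. In particular, convergence of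
  these coefficients to a nonzero limit entails that they are eventually well defined.
\<close>
definition clustering :: "nat \<Rightarrow> 'a sgraph \<Rightarrow> 'a \<Rightarrow> real" where
  "clustering k F w = real (nbr_cliques k F w) / real (degree F w choose k)"

lemma simple_graph_induced: "simple_graph F \<Longrightarrow> simple_graph (induced F S)"
  by (auto simp: simple_graph_def induced_def)

lemma adj_induced: "adj (induced F S) x y \<longleftrightarrow> adj F x y \<and> x \<in> S \<and> y \<in> S"
  by (auto simp: adj_def induced_def)

lemma adj_commute: "adj F x y \<longleftrightarrow> adj F y x"
  unfolding adj_def by (subst insert_commute) (rule refl)

lemma adj_simple_graph:
  assumes "simple_graph F" "adj F x y"
  shows "x \<in> verts F" "y \<in> verts F" "x \<noteq> y"
  using assms by (auto simp: simple_graph_def adj_def)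

lemma adj_tensor: "adj (tensor F K) (x, y) (x', y') \<longleftrightarrow> adj F x x' \<and> adj K y y'"
proof
  assume "adj (tensor F K) (x, y) (x', y')"
  then obtain a b a' b' where
    "{(x, y), (x', y')} = {(a, b), (a', b')}" "adj F a a'" "adj K b b'"
    unfolding adj_def[of "tensor F K"] unfolding tensor_def by auto
  then show "adj F x x' \<and> adj K y y'"
    using adj_commute[of F a a'] adj_commute[of K b b'] by (simp add: doubleton_eq_iff) blast
next
  assume "adj F x x' \<and> adj K y y'"
  then show "adj (tensor F K) (x, y) (x', y')"
    unfolding adj_def[of "tensor F K"] unfolding tensor_def by auto
qed

lemma simple_graph_tensor:
  assumes "simple_graph F" "simple_graph K"
  shows "simple_graph (tensor F K)"
  unfolding simple_graph_def
proof
  fix e assume "e \<in> edges (tensor F K)"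
  then obtain x y x' y' where e: "e = {(x, y), (x', y')}" "adj F x x'" "adj K y y'"
    by (auto simp: tensor_def)
  then show "e \<subseteq> verts (tensor F K) \<and> card e = 2"
    using adj_simple_graph[OF assms(1) e(2)] adj_simple_graph[OF assms(2) e(3)]
    by (simp add: tensor_def)
qed

section \<open>Random graphs on the positive integers\<close>

definition potential_edges :: "nat set set" where
  "potential_edges = {e. e \<subseteq> {1..} \<and> card e = 2}"

definition edge_event :: "'w measure \<Rightarrow> ('w \<Rightarrow> nat sgraph) \<Rightarrow> nat set \<Rightarrow> 'w set" where
  "edge_event M G e = {\<omega> \<in> space M. e \<in> edges (G \<omega>)}"

text \<open>
  A random simple graph with vertex set \<open>{1, 2, \<dots>}\<close> on the probability space \<open>M\<close>, whose edges
  are present independently with probability \<open>p\<close>. The graph that \<open>G\<close> induces on \<open>{1..n}\<close> is an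
  Erdos-Renyi graph with parameters \<open>n\<close> and \<open>p\<close>.
\<close>
definition infinite_ER_graph :: "'w measure \<Rightarrow> real \<Rightarrow> ('w \<Rightarrow> nat sgraph) \<Rightarrow> bool" where
  "infinite_ER_graph M p G \<longleftrightarrow>
     (\<forall>\<omega>\<in>space M. simple_graph (G \<omega>) \<and> verts (G \<omega>) = {1..}) \<and>
     prob_space.indep_events M (edge_event M G) potential_edges \<and>
     (\<forall>e\<in>potential_edges. measure M (edge_event M G e) = p)"

definition graph_sigma :: "'w measure \<Rightarrow> ('w \<Rightarrow> nat sgraph) \<Rightarrow> 'w set set" where
  "graph_sigma M G = sigma_sets (space M) (edge_event M G ` potential_edges)"

definition indep_graphs :: "'w measure \<Rightarrow> ('w \<Rightarrow> nat sgraph) \<Rightarrow> ('w \<Rightarrow> nat sgraph) \<Rightarrow> bool" where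
  "indep_graphs M G H \<longleftrightarrow> prob_space.indep_set M (graph_sigma M G) (graph_sigma M H)"

end

theory Submission
  imports Defs "HOL-Combinatorics.Multiset_Permutations"
begin

text \<open>
  Listing cliques as ordered tuples, a clique in a neighbourhood of \<open>G \<times> H\<close> is the same as a pair of
  tuples, one in each factor; hence \<open>A\<^sub>k(u, v) = k! A\<^sub>k(u) A\<^sub>k(v)\<close> and \<open>d(u, v) = d(u) d(v)\<close>. Since
  \<open>d = A\<^sub>1\<close>, it suffices that \<open>A\<^sub>k(u) / n ^ k\<close> tends almost surely to \<open>p ^ (k + 1 choose 2) / k!\<close>
  in a single graph. Disjoint \<open>k\<close>-sets give uncorrelated clique indicators, so the variance of
  \<open>A\<^sub>k(u)\<close> is at most \<open>n ^ (2 * k - 1)\<close>. After normalisation this is summable along the squares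
  \<open>n = m\<^sup>2\<close>, and monotonicity of \<open>A\<^sub>k(u)\<close> in \<open>n\<close> fills the gaps.
\<close>

section \<open>Ordered cliques in tensor products\<close>

text \<open>Every \<open>k\<close>-set has \<open>k!\<close> orderings, and different sets have no
  ordering in common.\<close>

lemma card_lists_of_sets:
  assumes "finite C" "\<And>S. S \<in> C \<Longrightarrow> finite S \<and> card S = k"
  shows "card {xs. distinct xs \<and> set xs \<in> C} = fact k * card C"
proof -
  have eq: "{xs. distinct xs \<and> set xs \<in> C} = (\<Union>S\<in>C. permutations_of_set S)"
    by (auto simp: permutations_of_set_def)
  have "card (\<Union>S\<in>C. permutations_of_set S) = (\<Sum>S\<in>C. card (permutations_of_set S))"
  proof (rule card_UN_disjoint)
    show "\<forall>S\<in>C. \<forall>T\<in>C. S \<noteq> T \<longrightarrow> permutations_of_set S \<inter> permutations_of_set T = {}"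
      unfolding permutations_of_set_def by blast
  qed (use assms in simp_all)
  also have "\<dots> = (\<Sum>S\<in>C. fact k)"
    by (rule sum.cong) (use assms in auto)
  finally show ?thesis by (simp add: eq)
qed

text \<open>Ordered tuples make the product structure bijective: two tuples zip to exactly one tuple
  of pairs, whereas two unordered \<open>k\<close>-sets can be matched up in \<open>k!\<close>
  ways.\<close>

definition clique_lists :: "nat \<Rightarrow> 'a sgraph \<Rightarrow> 'a \<Rightarrow> 'a list set" where
  "clique_lists k F w = {xs. length xs = k \<and> set xs \<subseteq> nbrs F w \<and> distinct xs \<and> pairwise (adj F) (set xs)}"

lemma card_clique_lists:
  assumes "finite (nbrs F w)"
  shows "card (clique_lists k F w) = fact k * nbr_cliques k F w"
proof -
  let ?C = "{S. S \<subseteq> nbrs F w \<and> finite S \<and> card S = k \<and> pairwise (adj F) S}"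
  have "clique_lists k F w = {xs. distinct xs \<and> set xs \<in> ?C}"
    by (auto simp: clique_lists_def distinct_card)
  moreover have "finite ?C"
    by (rule finite_subset[of _ "Pow (nbrs F w)"]) (use assms in auto)
  then have "card {xs. distinct xs \<and> set xs \<in> ?C} = fact k * card ?C"
    by (rule card_lists_of_sets) blast
  ultimately show ?thesis
    by (simp only: nbr_cliques_def)
qed

text \<open>For irreflexive \<open>R\<close>, being related at different positions already forces
  different entries. The clique condition thus becomes purely positional, the form that
  \<open>zip\<close> respects.\<close>

lemma distinct_pairwise_conv_nth:
  assumes "\<And>x. \<not> R x x"
  shows "distinct xs \<and> pairwise R (set xs) \<longleftrightarrow>
    (\<forall>i<length xs. \<forall>j<length xs. i \<noteq> j \<longrightarrow> R (xs ! i) (xs ! j))"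
    (is "?L \<longleftrightarrow> ?R")
proof
  assume ?L
  then show ?R by (simp add: pairwise_def distinct_conv_nth)
next
  assume R: ?R
  then have "distinct xs" using assms unfolding distinct_conv_nth by fastforce
  moreover have "pairwise R (set xs)"
  proof (rule pairwiseI)
    fix x y assume "x \<in> set xs" "y \<in> set xs" "x \<noteq> y"
    then show "R x y" using R unfolding in_set_conv_nth by blast
  qed
  ultimately show ?L ..
qed

lemma clique_lists_conv_nth:
  assumes "simple_graph F"
  shows "clique_lists k F w = {xs. length xs = k \<and> (\<forall>i<k. xs ! i \<in> nbrs F w) \<and>
    (\<forall>i<k. \<forall>j<k. i \<noteq> j \<longrightarrow> adj F (xs ! i) (xs ! j))}"
proof -
  have "\<not> adj F x x" for x
    using adj_simple_graph(3)[OF assms] by blast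
  from distinct_pairwise_conv_nth[of "adj F", OF this] show ?thesis
    unfolding clique_lists_def by (auto simp: subset_iff in_set_conv_nth)
qed

lemma nbrs_tensor: "nbrs (tensor F K) (u, v) = nbrs F u \<times> nbrs K v"
  by (auto simp: nbrs_def adj_tensor) (auto simp: tensor_def)

text \<open>Zipping and projecting are mutually inverse, and the positional conditions on a list of
  pairs split into those on its two coordinates. As the factors have no loops, both projections of a
  product clique again have distinct entries.\<close>

lemma bij_betw_clique_lists_tensor:
  assumes F: "simple_graph F" and K: "simple_graph K"
  shows "bij_betw (\<lambda>(xs, ys). zip xs ys) (clique_lists k F u \<times> clique_lists k K v)
    (clique_lists k (tensor F K) (u, v))"
proof (rule bij_betw_byWitness[where f' = "\<lambda>zs. (map fst zs, map snd zs)"])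
  note nth = clique_lists_conv_nth[OF F] clique_lists_conv_nth[OF K]
    clique_lists_conv_nth[OF simple_graph_tensor[OF F K]]
  show "\<forall>a\<in>clique_lists k F u \<times> clique_lists k K v.
      (map fst (case a of (xs, ys) \<Rightarrow> zip xs ys), map snd (case a of (xs, ys) \<Rightarrow> zip xs ys)) = a"
    by (auto simp: nth)
  show "\<forall>zs\<in>clique_lists k (tensor F K) (u, v).
      (case (map fst zs, map snd zs) of (xs, ys) \<Rightarrow> zip xs ys) = zs"
    by (simp add: zip_map_fst_snd)
  show "(\<lambda>(xs, ys). zip xs ys) ` (clique_lists k F u \<times> clique_lists k K v)
      \<subseteq> clique_lists k (tensor F K) (u, v)"
    by (auto simp: nth nbrs_tensor adj_tensor)
  have adj_iff: "adj (tensor F K) a b \<longleftrightarrow> adj F (fst a) (fst b) \<and> adj K (snd a) (snd b)" for a b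
    by (cases a; cases b) (simp add: adj_tensor)
  show "(\<lambda>zs. (map fst zs, map snd zs)) ` clique_lists k (tensor F K) (u, v)
      \<subseteq> clique_lists k F u \<times> clique_lists k K v"
    by (auto simp: nth nbrs_tensor mem_Times_iff adj_iff)
qed

text \<open>Counting ordered cliques gives \<open>k!\<close> times the left side as a product of two
  counts, each carrying its own \<open>k!\<close>; cancelling leaves one factor
  \<open>k!\<close>.\<close>

lemma nbr_cliques_tensor:
  assumes "simple_graph F" "simple_graph K" "finite (nbrs F u)" "finite (nbrs K v)"
  shows "nbr_cliques k (tensor F K) (u, v) = fact k * nbr_cliques k F u * nbr_cliques k K v"
proof -
  have "finite (nbrs (tensor F K) (u, v))"
    using assms(3,4) by (simp add: nbrs_tensor)
  then have "fact k * nbr_cliques k (tensor F K) (u, v) = card (clique_lists k (tensor F K) (u, v))"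
    by (simp only: card_clique_lists)
  also have "\<dots> = card (clique_lists k F u \<times> clique_lists k K v)"
    using bij_betw_same_card[OF bij_betw_clique_lists_tensor[OF assms(1,2)]] by (rule sym)
  also have "\<dots> = (fact k * nbr_cliques k F u) * (fact k * nbr_cliques k K v)"
    by (simp only: card_cartesian_product card_clique_lists[OF assms(3)] card_clique_lists[OF assms(4)])
  also have "\<dots> = fact k * (fact k * nbr_cliques k F u * nbr_cliques k K v)"
    by (simp only: mult.assoc mult.left_commute)
  finally show ?thesis
    by (rule mult_left_cancel[THEN iffD1, OF fact_nonzero])
qed

lemma degree_tensor: "degree (tensor F K) (u, v) = degree F u * degree K v"
  by (simp add: degree_def nbrs_tensor card_cartesian_product)

text \<open>This makes the degree a special case of clique counting, so that one limit theorem
  serves both numerator and denominator of the clustering coefficient.\<close>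

lemma nbr_cliques_1: "nbr_cliques 1 F w = degree F w"
proof -
  have "{S. S \<subseteq> nbrs F w \<and> finite S \<and> card S = 1 \<and> pairwise (adj F) S} = (\<lambda>x. {x}) ` nbrs F w"
    by (auto simp: card_1_singleton_iff)
  then show ?thesis
    by (simp add: nbr_cliques_def degree_def card_image inj_on_def)
qed

section \<open>Limits\<close>

text \<open>Up to \<open>k!\<close>, the binomial coefficient is a product of \<open>k\<close>
  factors \<open>m n - i\<close>. Dividing each by \<open>a n\<close> removes the shift
  \<open>i\<close> in the limit.\<close>

lemma tendsto_binomial_div_power:
  fixes m :: "nat \<Rightarrow> nat" and a :: "nat \<Rightarrow> real"
  assumes lim: "(\<lambda>n. real (m n) / a n) \<longlonglongrightarrow> c" and a: "filterlim a at_top sequentially"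
  shows "(\<lambda>n. real (m n choose k) / a n ^ k) \<longlonglongrightarrow> c ^ k / fact k"
proof -
  have "(\<lambda>n. (\<Prod>i = 0..<k. real (m n) / a n - real i / a n) / fact k)
      \<longlonglongrightarrow> (\<Prod>i = 0..<k. c - 0) / fact k"
    by (intro tendsto_intros lim real_tendsto_divide_at_top[OF tendsto_const a]) auto
  \<comment> \<open>The product is taken over the reals, so the identity also covers
    \<open>m n < k\<close>: the factor with \<open>i = m n\<close> is then zero.\<close>
  moreover have "real (m n choose k) / a n ^ k =
      (\<Prod>i = 0..<k. real (m n) / a n - real i / a n) / fact k" for n
    by (simp add: binomial_gbinomial gbinomial_prod_rev prod_dividef diff_divide_distrib[symmetric])
  ultimately show ?thesis by simp
qed

text \<open>Each \<open>n\<close> lies between consecutive squares \<open>s\<^sup>2\<close> and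
  \<open>(s + 1)\<^sup>2\<close>. Monotonicity squeezes \<open>f n / n ^ k\<close> between the
  values at these squares, each divided by the power of the other square; replacing that power by
  the matching one costs a factor tending to 1.\<close>

lemma tendsto_div_power_from_squares:
  fixes f :: "nat \<Rightarrow> real"
  assumes "mono f" and nonneg: "\<And>n. 0 \<le> f n"
    and lim: "(\<lambda>m. f (m\<^sup>2) / real (m\<^sup>2) ^ k) \<longlonglongrightarrow> c"
  shows "(\<lambda>n. f n / real n ^ k) \<longlonglongrightarrow> c"
proof -
  define s :: "nat \<Rightarrow> nat" where "s n = nat \<lfloor>sqrt (real n)\<rfloor>" for n
  have s_le: "(s n)\<^sup>2 \<le> n" for n
  proof -
    have "real (s n) \<le> sqrt (real n)" by (simp add: s_def)
    then have "(real (s n))\<^sup>2 \<le> real n"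
      using power_mono[of "real (s n)" "sqrt (real n)" 2] by simp
    then show ?thesis by (metis of_nat_le_iff of_nat_power)
  qed
  have s_gt: "n \<le> (Suc (s n))\<^sup>2" for n
  proof -
    have "sqrt (real n) \<le> real (Suc (s n))" by (simp add: s_def) linarith
    then have "real n \<le> (real (Suc (s n)))\<^sup>2"
      using power_mono[of "sqrt (real n)" "real (Suc (s n))" 2] by simp
    then show ?thesis by (metis of_nat_le_iff of_nat_power)
  qed
  have s_top: "filterlim s at_top sequentially"
    unfolding filterlim_at_top
  proof
    fix Z :: nat
    have "Z \<le> s n" if "Z\<^sup>2 \<le> n" for n
    proof -
      have "real Z \<le> sqrt (real n)"
        using that by (intro real_le_rsqrt) (metis of_nat_le_iff of_nat_power)
      then show ?thesis by (simp add: s_def le_nat_floor)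
    qed
    then show "\<forall>\<^sub>F n in sequentially. Z \<le> s n"
      using eventually_at_top_linorder by blast
  qed
  have ratio: "(\<lambda>m. (real m / real (Suc m)) ^ (2 * k)) \<longlonglongrightarrow> 1 ^ (2 * k)"
    by (intro tendsto_power LIMSEQ_n_over_Suc_n)
  have ratio': "(\<lambda>m. (real (Suc m) / real m) ^ (2 * k)) \<longlonglongrightarrow> 1 ^ (2 * k)"
    by (intro tendsto_power LIMSEQ_Suc_n_over_n)
  have lower: "(\<lambda>m. f (m\<^sup>2) / real (m\<^sup>2) ^ k * (real m / real (Suc m)) ^ (2 * k)) \<longlonglongrightarrow> c"
    using tendsto_mult[OF lim ratio] by simp
  have upper: "(\<lambda>m. f ((Suc m)\<^sup>2) / real ((Suc m)\<^sup>2) ^ k * (real (Suc m) / real m) ^ (2 * k)) \<longlonglongrightarrow> c"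
    using tendsto_mult[OF LIMSEQ_Suc[OF lim] ratio'] by simp
  \<comment> \<open>Cancelling the correction factors against the denominators requires
    \<open>s n\<close> to be nonzero.\<close>
  have s_pos: "\<forall>\<^sub>F n in sequentially. 1 \<le> s n"
    using s_top by (simp add: filterlim_at_top)
  show ?thesis
  proof (rule tendsto_sandwich[OF _ _ filterlim_compose[OF lower s_top] filterlim_compose[OF upper s_top]])
    show "\<forall>\<^sub>F n in sequentially. f ((s n)\<^sup>2) / real ((s n)\<^sup>2) ^ k * (real (s n) / real (Suc (s n))) ^ (2 * k)
        \<le> f n / real n ^ k"
      using s_pos
    proof eventually_elim
      case (elim n)
      have "f ((s n)\<^sup>2) / real ((s n)\<^sup>2) ^ k * (real (s n) / real (Suc (s n))) ^ (2 * k)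
          = f ((s n)\<^sup>2) / real ((Suc (s n))\<^sup>2) ^ k"
        using elim by (simp add: power_divide power_mult del: of_nat_Suc)
      also have "\<dots> \<le> f n / real n ^ k"
      proof (rule frac_le)
        have "0 < n" using elim s_le[of n] by (cases n) auto
        then show "0 < real n ^ k" by simp
        show "real n ^ k \<le> real ((Suc (s n))\<^sup>2) ^ k"
          using s_gt[of n] by (intro power_mono) (auto simp del: of_nat_Suc simp flip: of_nat_le_iff)
      qed (use nonneg monoD[OF \<open>mono f\<close> s_le] in auto)
      finally show ?case .
    qed
    show "\<forall>\<^sub>F n in sequentially. f n / real n ^ k
        \<le> f ((Suc (s n))\<^sup>2) / real ((Suc (s n))\<^sup>2) ^ k * (real (Suc (s n)) / real (s n)) ^ (2 * k)"
      using s_pos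
    proof eventually_elim
      case (elim n)
      have "f n / real n ^ k \<le> f ((Suc (s n))\<^sup>2) / real ((s n)\<^sup>2) ^ k"
      proof (rule frac_le)
        show "0 < real ((s n)\<^sup>2) ^ k" using elim by simp
        show "real ((s n)\<^sup>2) ^ k \<le> real n ^ k"
          using s_le[of n] by (intro power_mono) (auto simp flip: of_nat_le_iff)
      qed (use nonneg monoD[OF \<open>mono f\<close> s_gt] in auto)
      also have "\<dots> = f ((Suc (s n))\<^sup>2) / real ((Suc (s n))\<^sup>2) ^ k * (real (Suc (s n)) / real (s n)) ^ (2 * k)"
        using elim by (simp add: power_divide power_mult del: of_nat_Suc)
      finally show ?case .
    qed
  qed
qed

section \<open>Almost sure convergence from second moments\<close>

text \<open>Sum and integral commute for nonnegative terms, so the series of squares has finite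
  integral. It therefore converges almost everywhere, and its terms tend to 0.\<close>

lemma AE_tendsto_0_if_summable_second_moments:
  fixes Y :: "nat \<Rightarrow> 'a \<Rightarrow> real"
  assumes int: "\<And>n. integrable M (\<lambda>x. (Y n x)\<^sup>2)"
    and summable: "summable (\<lambda>n. \<integral>x. (Y n x)\<^sup>2 \<partial>M)"
  shows "AE x in M. (\<lambda>n. Y n x) \<longlonglongrightarrow> 0"
proof -
  have [measurable]: "(\<lambda>x. (Y n x)\<^sup>2) \<in> borel_measurable M" for n
    using int by (rule borel_measurable_integrable)
  have "(\<integral>\<^sup>+x. (\<Sum>n. ennreal ((Y n x)\<^sup>2)) \<partial>M) = (\<Sum>n. \<integral>\<^sup>+x. ennreal ((Y n x)\<^sup>2) \<partial>M)"
    by (rule nn_integral_suminf) measurable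
  also have "\<dots> = (\<Sum>n. ennreal (\<integral>x. (Y n x)\<^sup>2 \<partial>M))"
    by (simp add: nn_integral_eq_integral int)
  also have "\<dots> = ennreal (\<Sum>n. \<integral>x. (Y n x)\<^sup>2 \<partial>M)"
    by (rule suminf_ennreal2) (use summable in auto)
  finally have "(\<integral>\<^sup>+x. (\<Sum>n. ennreal ((Y n x)\<^sup>2)) \<partial>M) \<noteq> \<infinity>" by simp
  then have "AE x in M. (\<Sum>n. ennreal ((Y n x)\<^sup>2)) \<noteq> \<infinity>"
    by (intro nn_integral_noteq_infinite) measurable
  then show ?thesis
  proof eventually_elim
    case (elim x)
    then have "summable (\<lambda>n. (Y n x)\<^sup>2)"
      by (intro summable_suminf_not_top) auto
    then have "(\<lambda>n. (Y n x)\<^sup>2) \<longlonglongrightarrow> 0" by (rule summable_LIMSEQ_zero)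
    then show ?case using tendsto_rabs_zero_cancel tendsto_real_sqrt[of "\<lambda>n. (Y n x)\<^sup>2" 0]
      by (auto simp: real_sqrt_abs)
  qed
qed

text \<open>The assumption on the variance is the bound \<open>n ^ (2 * k - 1)\<close> with the
  missing factor \<open>n\<close> moved to the left. After normalisation it gives order
  \<open>1 / n\<close>, which is not summable over all \<open>n\<close> but becomes
  \<open>1 / m\<^sup>2\<close> along \<open>n = m\<^sup>2\<close>. Monotonicity then interpolates
  between the squares.\<close>

lemma (in prob_space) AE_tendsto_if_variance_bound:
  fixes Z :: "nat \<Rightarrow> 'a \<Rightarrow> real"
  assumes meas: "\<And>n. random_variable borel (Z n)"
    and bounded: "\<And>n. \<exists>B. \<forall>x\<in>space M. \<bar>Z n x\<bar> \<le> B"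
    and mono: "\<And>x. mono (\<lambda>n. Z n x)" and nonneg: "\<And>n x. 0 \<le> Z n x"
    and var: "\<And>n. real n * variance (Z n) \<le> real n ^ (2 * k)"
    and mean: "(\<lambda>n. expectation (Z n) / real n ^ k) \<longlonglongrightarrow> c"
  shows "AE x in M. (\<lambda>n. Z n x / real n ^ k) \<longlonglongrightarrow> c"
proof -
  define Y where "Y m x = (Z (m\<^sup>2) x - expectation (Z (m\<^sup>2))) / real (m\<^sup>2) ^ k" for m x
  have int: "integrable M (\<lambda>x. (Z n x - a)\<^sup>2)" for n a
  proof -
    obtain B where B: "\<And>x. x \<in> space M \<Longrightarrow> \<bar>Z n x\<bar> \<le> B" using bounded by blast
    show ?thesis
    proof (rule integrable_const_bound[where B = "(B + \<bar>a\<bar>)\<^sup>2"])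
      show "AE x in M. norm ((Z n x - a)\<^sup>2) \<le> (B + \<bar>a\<bar>)\<^sup>2"
      proof (rule AE_I2)
        fix x assume "x \<in> space M"
        then have "\<bar>Z n x - a\<bar> \<le> \<bar>B + \<bar>a\<bar>\<bar>" using B[of x] by linarith
        then show "norm ((Z n x - a)\<^sup>2) \<le> (B + \<bar>a\<bar>)\<^sup>2"
          by (simp add: abs_le_square_iff)
      qed
    qed (use meas in measurable)
  qed
  have "AE x in M. (\<lambda>m. Y m x) \<longlonglongrightarrow> 0"
  proof (rule AE_tendsto_0_if_summable_second_moments)
    show "integrable M (\<lambda>x. (Y m x)\<^sup>2)" for m
      using int by (simp add: Y_def power_divide)
    show "summable (\<lambda>m. expectation (\<lambda>x. (Y m x)\<^sup>2))"
    proof (rule summable_comparison_test'[where N = 1])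
      show "summable (\<lambda>m. inverse (real m ^ 2))"
        by (rule inverse_power_summable) simp
      fix m :: nat assume m: "m \<ge> 1"
      let ?V = "variance (Z (m\<^sup>2))"
      have "expectation (\<lambda>x. (Y m x)\<^sup>2) = ?V / real (m\<^sup>2) ^ (2 * k)"
        by (simp add: Y_def power_divide power_even_eq)
      \<comment> \<open>At \<open>n = m\<^sup>2\<close> the variance assumption carries the factor
        \<open>m\<^sup>2\<close>; \<open>m \<ge> 1\<close> permits dividing by it.\<close>
      also have "\<dots> \<le> inverse (real m ^ 2)"
        using var[of "m\<^sup>2"] m by (simp add: field_simps)
      finally show "norm (expectation (\<lambda>x. (Y m x)\<^sup>2)) \<le> inverse (real m ^ 2)" by simp
    qed
  qed
  then show ?thesis
  proof eventually_elim
    case (elim x)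
    have sq: "filterlim (\<lambda>m::nat. m\<^sup>2) at_top sequentially"
      by (rule filterlim_subseq) (simp add: strict_mono_def power_strict_mono)
    have "(\<lambda>m. Y m x + expectation (Z (m\<^sup>2)) / real (m\<^sup>2) ^ k) \<longlonglongrightarrow> 0 + c"
      by (rule tendsto_add[OF elim filterlim_compose[OF mean sq]])
    then have "(\<lambda>m. Z (m\<^sup>2) x / real (m\<^sup>2) ^ k) \<longlonglongrightarrow> c"
      by (simp add: Y_def diff_divide_distrib)
    then show ?case
      by (rule tendsto_div_power_from_squares[OF mono nonneg])
  qed
qed

section \<open>Cliques in the neighbourhood of a fixed vertex\<close>

definition pairs_of :: "'a set \<Rightarrow> 'a set set" where
  "pairs_of W = {e. e \<subseteq> W \<and> card e = 2}"

lemma finite_pairs_of: "finite W \<Longrightarrow> finite (pairs_of W)"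
  unfolding pairs_of_def by (rule finite_subset[of _ "Pow W"]) auto

lemma card_pairs_of: "finite W \<Longrightarrow> card (pairs_of W) = card W choose 2"
  unfolding pairs_of_def by (rule n_subsets)

text \<open>The two vertex sets share only \<open>u\<close>, and no pair fits into a single point.
  Disjoint candidate sets thus depend on disjoint sets of edges, which is why their indicators are
  uncorrelated.\<close>

lemma pairs_of_Int_insert:
  assumes "S \<inter> T = {}"
  shows "pairs_of (insert u S) \<inter> pairs_of (insert u T) = {}"
proof -
  have False if "e \<subseteq> insert u S" "e \<subseteq> insert u T" "card e = 2" for e
  proof -
    have "e \<subseteq> {u}" using that assms by blast
    then show False using card_mono[of "{u}" e] that by simp
  qed
  then show ?thesis by (auto simp: pairs_of_def)
qed

text \<open>A clique in the neighbourhood of \<open>u\<close> is a clique through \<open>u\<close>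
  with \<open>u\<close> removed. In this form the event is a single inclusion of edge sets, whose
  probability independence gives directly.\<close>

lemma pairs_of_insert_subset_edges_iff:
  assumes "simple_graph F" "u \<notin> S"
  shows "pairs_of (insert u S) \<subseteq> edges F \<longleftrightarrow> S \<subseteq> nbrs F u \<and> pairwise (adj F) S"
proof
  assume L: "pairs_of (insert u S) \<subseteq> edges F"
  have "adj F x y" if "x \<in> insert u S" "y \<in> insert u S" "x \<noteq> y" for x y
    using that subsetD[OF L, of "{x, y}"] by (simp add: adj_def pairs_of_def)
  then show "S \<subseteq> nbrs F u \<and> pairwise (adj F) S"
    using assms adj_simple_graph(2)[OF assms(1)] unfolding nbrs_def pairwise_def
    by (metis (no_types, lifting) insert_iff mem_Collect_eq subsetI)
next
  assume R: "S \<subseteq> nbrs F u \<and> pairwise (adj F) S"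
  show "pairs_of (insert u S) \<subseteq> edges F"
  proof
    fix e assume "e \<in> pairs_of (insert u S)"
    then obtain x y where xy: "e = {x, y}" "x \<noteq> y" "x \<in> insert u S" "y \<in> insert u S"
      by (auto simp: pairs_of_def card_2_iff)
    then have "adj F x y"
      using R adj_commute[of F x y] by (auto simp: nbrs_def pairwise_def)
    then show "e \<in> edges F" by (simp add: adj_def xy)
  qed
qed

section \<open>Counting candidate sets and intersecting pairs of them\<close>

definition punctured_subsets :: "nat \<Rightarrow> nat \<Rightarrow> nat \<Rightarrow> nat set set" where
  "punctured_subsets u k n = {S. S \<subseteq> {1..n} - {u} \<and> card S = k}"

lemma finite_punctured_subsets: "finite (punctured_subsets u k n)"
  unfolding punctured_subsets_def by (rule finite_subset[of _ "Pow {1..n}"]) auto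

lemma card_punctured_subsets: "card (punctured_subsets u k n) = card ({1..n} - {u}) choose k"
  unfolding punctured_subsets_def by (rule n_subsets) simp

lemma punctured_subsetsD:
  assumes "S \<in> punctured_subsets u k n"
  shows "finite S" "card S = k" "u \<notin> S" "S \<subseteq> {1..}"
  using assms finite_subset[of S "{1..n} - {u}"] by (auto simp: punctured_subsets_def)

text \<open>Deleting \<open>x\<close> maps these sets injectively to \<open>(k - 1)\<close>-subsets
  of \<open>{1..n}\<close>.\<close>

lemma card_punctured_subsets_containing:
  assumes "1 \<le> k"
  shows "card {S \<in> punctured_subsets u k n. x \<in> S} \<le> n ^ (k - 1)"
proof -
  have inj: "inj_on (\<lambda>S. S - {x}) {S \<in> punctured_subsets u k n. x \<in> S}"
    by (rule inj_onI) blast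
  have "(\<lambda>S. S - {x}) ` {S \<in> punctured_subsets u k n. x \<in> S} \<subseteq> {T. T \<subseteq> {1..n} \<and> card T = k - 1}"
    by (auto simp: punctured_subsets_def card_Diff_singleton)
  then have "card {S \<in> punctured_subsets u k n. x \<in> S} \<le> card {T. T \<subseteq> {1..n} \<and> card T = k - 1}"
    by (rule card_inj_on_le[OF inj]) simp
  also have "\<dots> = n choose (k - 1)" by (simp add: n_subsets)
  also have "\<dots> \<le> n ^ (k - 1)"
    by (cases "k - 1 \<le> n") (auto simp: binomial_le_pow binomial_eq_0)
  finally show ?thesis .
qed

text \<open>Choose a common element in at most \<open>n\<close> ways, then each of the two sets in
  at most \<open>n ^ (k - 1)\<close> ways. The extra factor \<open>n\<close> on the left avoids the
  exponent \<open>2 * k - 1\<close>.\<close>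

lemma card_intersecting_pairs:
  assumes "1 \<le> k"
  shows "n * card {(S, T). S \<in> punctured_subsets u k n \<and> T \<in> punctured_subsets u k n \<and> S \<inter> T \<noteq> {}}
    \<le> n ^ (2 * k)"
proof -
  let ?A = "\<lambda>x. {S \<in> punctured_subsets u k n. x \<in> S}"
  have fin: "finite (?A x)" for x using finite_punctured_subsets by simp
  have "card {(S, T). S \<in> punctured_subsets u k n \<and> T \<in> punctured_subsets u k n \<and> S \<inter> T \<noteq> {}}
      \<le> card (\<Union>x\<in>{1..n}. ?A x \<times> ?A x)"
    by (rule card_mono) (use fin in \<open>auto simp: punctured_subsets_def\<close>)
  also have "\<dots> \<le> (\<Sum>x\<in>{1..n}. card (?A x \<times> ?A x))"
    by (rule card_UN_le) simp
  also have "\<dots> \<le> (\<Sum>x\<in>{1..n}. n ^ (k - 1) * n ^ (k - 1))"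
    unfolding card_cartesian_product
    by (intro sum_mono mult_mono card_punctured_subsets_containing assms) auto
  also have "\<dots> = n * n ^ (k - 1) * n ^ (k - 1)" by simp
  finally have "n * card {(S, T). S \<in> punctured_subsets u k n \<and> T \<in> punctured_subsets u k n \<and> S \<inter> T \<noteq> {}}
      \<le> (n * n ^ (k - 1)) * (n * n ^ (k - 1))"
    by (simp add: mult.assoc mult.left_commute mult_le_mono2)
  also have "\<dots> = n ^ (2 * k)"
    using assms by (cases k) (simp_all add: mult_2 power_add)
  finally show ?thesis .
qed

text \<open>The index set on the right does not depend on the graph, so for a random graph the count
  becomes a sum of indicators over a fixed family.\<close>

lemma nbr_cliques_induced:
  assumes "simple_graph F" "verts F = {1..}" "1 \<le> u" "u \<le> n"
  shows "nbr_cliques k (induced F {1..n}) u =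
    card {S \<in> punctured_subsets u k n. pairs_of (insert u S) \<subseteq> edges F}"
proof -
  have nbrs: "nbrs (induced F {1..n}) u = nbrs F u \<inter> {1..n}"
    using assms by (auto simp: nbrs_def adj_induced) (auto simp: induced_def)
  have u: "u \<notin> nbrs F u"
    using adj_simple_graph(3)[OF assms(1)] by (auto simp: nbrs_def)
  have "S \<subseteq> nbrs (induced F {1..n}) u \<and> finite S \<and> card S = k \<and> pairwise (adj (induced F {1..n})) S
      \<longleftrightarrow> S \<in> punctured_subsets u k n \<and> pairs_of (insert u S) \<subseteq> edges F" for S
  proof (cases "S \<subseteq> {1..n} - {u}")
    case True
    moreover have "finite S" using True finite_subset by blast
    moreover have "pairwise (adj (induced F {1..n})) S \<longleftrightarrow> pairwise (adj F) S"
      using True by (auto simp: pairwise_def adj_induced)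
    moreover have "pairs_of (insert u S) \<subseteq> edges F \<longleftrightarrow> S \<subseteq> nbrs F u \<and> pairwise (adj F) S"
      using True by (intro pairs_of_insert_subset_edges_iff assms(1)) blast
    moreover have "S \<subseteq> nbrs (induced F {1..n}) u \<longleftrightarrow> S \<subseteq> nbrs F u"
      using True unfolding nbrs by blast
    ultimately show ?thesis
      by (simp only: punctured_subsets_def) blast
  next
    case False
    then have "\<not> S \<subseteq> nbrs (induced F {1..n}) u" using u unfolding nbrs by blast
    with False show ?thesis by (simp only: punctured_subsets_def mem_Collect_eq) blast
  qed
  then show ?thesis by (simp add: nbr_cliques_def)
qed

section \<open>Edge probabilities and the almost sure limit in a single graph\<close>

lemma (in prob_space) infinite_ER_graph_prob_subset_edges:
  assumes "infinite_ER_graph M p G" "J \<subseteq> potential_edges" "finite J"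
  shows "{\<omega> \<in> space M. J \<subseteq> edges (G \<omega>)} \<in> events"
    and "prob {\<omega> \<in> space M. J \<subseteq> edges (G \<omega>)} = p ^ card J"
proof -
  have ind: "indep_events (edge_event M G) potential_edges"
    and pr: "\<And>e. e \<in> potential_edges \<Longrightarrow> prob (edge_event M G e) = p"
    using assms(1) by (auto simp: infinite_ER_graph_def)
  have ev: "edge_event M G e \<in> events" if "e \<in> potential_edges" for e
    using that ind by (auto simp: indep_events_def)
  \<comment> \<open>The empty family is treated apart: its intersection is \<open>UNIV\<close>
    rather than \<open>space M\<close>, and \<open>indep_events\<close> speaks of nonempty families
    only.\<close>
  have eq: "{\<omega> \<in> space M. J \<subseteq> edges (G \<omega>)} = (\<Inter>e\<in>J. edge_event M G e)" if "J \<noteq> {}"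
    using that by (auto simp: edge_event_def)
  show "{\<omega> \<in> space M. J \<subseteq> edges (G \<omega>)} \<in> events"
  proof (cases "J = {}")
    case False
    then show ?thesis
      unfolding eq[OF False] using ev assms by (intro sets.finite_INT) auto
  qed simp
  show "prob {\<omega> \<in> space M. J \<subseteq> edges (G \<omega>)} = p ^ card J"
  proof (cases "J = {}")
    case False
    have "prob (\<Inter>e\<in>J. edge_event M G e) = (\<Prod>e\<in>J. prob (edge_event M G e))"
      using ind assms(2,3) False by (auto simp: indep_events_def)
    also have "\<dots> = (\<Prod>e\<in>J. p)"
      by (rule prod.cong) (use pr assms(2) in auto)
    finally show ?thesis by (simp add: eq[OF False])
  qed (simp add: prob_space)
qed

text \<open>A \<open>k\<close>-clique together with \<open>u\<close> spans
  \<open>k + (k choose 2) = (Suc k choose 2)\<close> edges, and there are about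
  \<open>n ^ k / k!\<close> candidate sets. For \<open>k = 1\<close> the limit is \<open>p\<close>,
  the normalised degree.\<close>

lemma (in prob_space) AE_nbr_cliques_tendsto:
  assumes G: "infinite_ER_graph M p G" and p: "0 < p" "p < 1" and k: "1 \<le> k" and u: "1 \<le> u"
  shows "AE \<omega> in M. (\<lambda>n. real (nbr_cliques k (induced (G \<omega>) {1..n}) u) / real n ^ k)
    \<longlonglongrightarrow> p ^ (Suc k choose 2) / fact k"
proof -
  define P where "P S = pairs_of (insert u S)" for S
  define I where "I S \<omega> = (of_bool (P S \<subseteq> edges (G \<omega>)) :: real)" for S \<omega>
  let ?\<Sigma> = "punctured_subsets u k"
  let ?q = "p ^ (Suc k choose 2)"
  \<comment> \<open>For \<open>n < u\<close> this may differ from the clique count in the induced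
    graph; the limit only sees \<open>n \<ge> u\<close>.\<close>
  define Z where "Z n \<omega> = (\<Sum>S\<in>?\<Sigma> n. I S \<omega>)" for n \<omega>
  have P: "finite (P S)" "P S \<subseteq> potential_edges" "card (P S) = Suc k choose 2" if "S \<in> ?\<Sigma> n" for S n
  proof -
    note S = punctured_subsetsD[OF that]
    show "finite (P S)" using S by (simp add: P_def finite_pairs_of)
    show "P S \<subseteq> potential_edges" using S(4) u by (auto simp: P_def pairs_of_def potential_edges_def)
    show "card (P S) = Suc k choose 2" using S by (simp add: P_def card_pairs_of)
  qed
  have edges: "integrable M (\<lambda>\<omega>. of_bool (J \<subseteq> edges (G \<omega>)) :: real)"
      "expectation (\<lambda>\<omega>. of_bool (J \<subseteq> edges (G \<omega>))) = p ^ card J"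
    if "finite J" "J \<subseteq> potential_edges" for J
  proof -
    let ?E = "{\<omega> \<in> space M. J \<subseteq> edges (G \<omega>)}"
    note E = infinite_ER_graph_prob_subset_edges[OF G that(2,1)]
    \<comment> \<open>Outside \<open>space M\<close> the two functions may differ, so they are
      exchanged by congruence under the integral.\<close>
    have ind: "\<omega> \<in> space M \<Longrightarrow> of_bool (J \<subseteq> edges (G \<omega>)) = (indicator ?E \<omega> :: real)" for \<omega>
      by (simp add: indicator_def)
    show "integrable M (\<lambda>\<omega>. of_bool (J \<subseteq> edges (G \<omega>)) :: real)"
      using E(1) by (subst Bochner_Integration.integrable_cong[OF refl ind]) (auto simp: emeasure_eq_measure)
    show "expectation (\<lambda>\<omega>. of_bool (J \<subseteq> edges (G \<omega>))) = p ^ card J"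
      using E by (subst Bochner_Integration.integral_cong[OF refl ind]) (auto simp: Int_absorb2)
  qed
  have I: "integrable M (I S)" "expectation (I S) = ?q" if "S \<in> ?\<Sigma> n" for S n
    using edges[OF P(1,2)[OF that]] P(3)[OF that] by (simp_all add: I_def[abs_def])
  \<comment> \<open>An edge shared by both cliques is required only once, hence the union and its
    cardinality in the mixed moments.\<close>
  have II_eq: "I S \<omega> * I T \<omega> = of_bool (P S \<union> P T \<subseteq> edges (G \<omega>))" for S T \<omega>
    by (simp add: I_def)
  have II: "integrable M (\<lambda>\<omega>. I S \<omega> * I T \<omega>)"
      "expectation (\<lambda>\<omega>. I S \<omega> * I T \<omega>) = p ^ card (P S \<union> P T)"
    if "S \<in> ?\<Sigma> n" "T \<in> ?\<Sigma> n" for S T n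
    unfolding II_eq using edges[of "P S \<union> P T"] P[OF that(1)] P[OF that(2)] by simp_all
  have EZ: "expectation (Z n) = real (card (?\<Sigma> n)) * ?q" for n
    unfolding Z_def[abs_def] by (subst Bochner_Integration.integral_sum) (auto simp: I)
  have Z_sq: "(Z n \<omega>)\<^sup>2 = (\<Sum>(S, T)\<in>?\<Sigma> n \<times> ?\<Sigma> n. I S \<omega> * I T \<omega>)" for n \<omega>
    by (simp add: Z_def power2_eq_square sum_product sum.cartesian_product)
  have var: "real n * variance (Z n) \<le> real n ^ (2 * k)" for n
  proof -
    let ?D = "{(S, T). S \<in> ?\<Sigma> n \<and> T \<in> ?\<Sigma> n \<and> S \<inter> T \<noteq> {}}"
    have fin: "finite (?\<Sigma> n \<times> ?\<Sigma> n)" using finite_punctured_subsets by blast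
    have "variance (Z n) = expectation (\<lambda>\<omega>. (Z n \<omega>)\<^sup>2) - (expectation (Z n))\<^sup>2"
    proof (rule variance_eq)
      show "integrable M (Z n)"
        unfolding Z_def[abs_def] by (rule Bochner_Integration.integrable_sum) (rule I)
      show "integrable M (\<lambda>\<omega>. (Z n \<omega>)\<^sup>2)"
        unfolding Z_sq by (rule Bochner_Integration.integrable_sum) (auto intro: II)
    qed
    also have "expectation (\<lambda>\<omega>. (Z n \<omega>)\<^sup>2) = (\<Sum>(S, T)\<in>?\<Sigma> n \<times> ?\<Sigma> n. p ^ card (P S \<union> P T))"
      unfolding Z_sq
      by (subst Bochner_Integration.integral_sum) (auto intro: II intro!: sum.cong simp: II(2))
    also have "(expectation (Z n))\<^sup>2 = (\<Sum>(S, T)\<in>?\<Sigma> n \<times> ?\<Sigma> n. ?q * ?q)"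
      by (simp add: EZ power2_eq_square card_cartesian_product)
    also have "(\<Sum>(S, T)\<in>?\<Sigma> n \<times> ?\<Sigma> n. p ^ card (P S \<union> P T)) - (\<Sum>(S, T)\<in>?\<Sigma> n \<times> ?\<Sigma> n. ?q * ?q)
        = (\<Sum>(S, T)\<in>?\<Sigma> n \<times> ?\<Sigma> n. p ^ card (P S \<union> P T) - ?q * ?q)"
      by (simp add: sum_subtractf case_prod_unfold)
    \<comment> \<open>Each summand is a covariance: it vanishes for disjoint \<open>S\<close> and
      \<open>T\<close>, where the edge counts add up, and is at most 1 otherwise. The variance is
      thus bounded by the number of intersecting pairs.\<close>
    also have "\<dots> \<le> (\<Sum>(S, T)\<in>?\<Sigma> n \<times> ?\<Sigma> n. of_bool (S \<inter> T \<noteq> {}))"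
    proof (intro sum_mono, clarify)
      fix S T assume ST: "S \<in> ?\<Sigma> n" "T \<in> ?\<Sigma> n"
      show "p ^ card (P S \<union> P T) - ?q * ?q \<le> of_bool (S \<inter> T \<noteq> {})"
      proof (cases "S \<inter> T = {}")
        case True
        then have "card (P S \<union> P T) = card (P S) + card (P T)"
          using P(1)[OF ST(1)] P(1)[OF ST(2)]
          by (intro card_Un_disjoint) (auto simp: P_def pairs_of_Int_insert)
        then show ?thesis using True P(3)[OF ST(1)] P(3)[OF ST(2)] by (simp add: power_add)
      next
        case False
        have "p ^ card (P S \<union> P T) \<le> 1" using p by (simp add: power_le_one)
        moreover have "0 \<le> ?q * ?q" using p by (intro mult_nonneg_nonneg zero_le_power) simp_all
        moreover have "of_bool (S \<inter> T \<noteq> {}) = (1 :: real)" using False by simp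
        ultimately show ?thesis by linarith
      qed
    qed
    also have "\<dots> = (\<Sum>x\<in>?\<Sigma> n \<times> ?\<Sigma> n. if x \<in> ?D then 1 else 0)"
      by (rule sum.cong) auto
    also have "\<dots> = real (card ?D)"
    proof -
      have "(?\<Sigma> n \<times> ?\<Sigma> n) \<inter> {x. x \<in> ?D} = ?D" by blast
      then show ?thesis by (simp only: sum.inter_restrict[OF fin, symmetric] Collect_mem_eq) simp
    qed
    finally have "real n * variance (Z n) \<le> real n * real (card ?D)"
      by (rule mult_left_mono) simp
    also have "\<dots> = real (n * card ?D)" by simp
    also have "\<dots> \<le> real (n ^ (2 * k))"
      using card_intersecting_pairs[OF k, of n u] by (simp only: of_nat_le_iff)
    finally show ?thesis by simp
  qed
  have "(\<lambda>n. real (card ({1..n} - {u})) / real n) \<longlonglongrightarrow> 1"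
  proof (rule Lim_transform_eventually)
    have "(\<lambda>n. 1 - 1 / real n) \<longlonglongrightarrow> 1 - 0"
      by (intro tendsto_intros lim_1_over_n)
    then show "(\<lambda>n. 1 - 1 / real n) \<longlonglongrightarrow> 1" by simp
    \<comment> \<open>Removing \<open>u\<close> lowers the cardinality to \<open>n - 1\<close> only
      once \<open>u \<le> n\<close>.\<close>
    show "\<forall>\<^sub>F n in sequentially. 1 - 1 / real n = real (card ({1..n} - {u})) / real n"
      using eventually_ge_at_top[of u]
      by eventually_elim (use u in \<open>simp add: card_Diff_singleton of_nat_diff field_simps\<close>)
  qed
  then have "(\<lambda>n. real (card (?\<Sigma> n)) / real n ^ k * ?q) \<longlonglongrightarrow> 1 ^ k / fact k * ?q"
    unfolding card_punctured_subsets
    by (intro tendsto_mult tendsto_const tendsto_binomial_div_power filterlim_real_sequentially)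
  then have mean: "(\<lambda>n. expectation (Z n) / real n ^ k) \<longlonglongrightarrow> ?q / fact k"
    by (simp add: EZ)
  have "AE \<omega> in M. (\<lambda>n. Z n \<omega> / real n ^ k) \<longlonglongrightarrow> ?q / fact k"
  proof (rule AE_tendsto_if_variance_bound[OF _ _ _ _ var mean])
    show "random_variable borel (Z n)" for n
      unfolding Z_def[abs_def] by (intro borel_measurable_sum borel_measurable_integrable) (rule I)
    show "\<exists>B. \<forall>\<omega>\<in>space M. \<bar>Z n \<omega>\<bar> \<le> B" for n
    proof (intro exI ballI)
      fix \<omega>
      have "\<bar>Z n \<omega>\<bar> \<le> (\<Sum>S\<in>?\<Sigma> n. \<bar>I S \<omega>\<bar>)" unfolding Z_def by (rule sum_abs)
      also have "\<dots> \<le> (\<Sum>S\<in>?\<Sigma> n. 1)" by (rule sum_mono) (simp add: I_def)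
      finally show "\<bar>Z n \<omega>\<bar> \<le> (\<Sum>S\<in>?\<Sigma> n. 1)" .
    qed
    show "mono (\<lambda>n. Z n \<omega>)" for \<omega>
      unfolding Z_def
      by (intro monoI sum_mono2 finite_punctured_subsets) (auto simp: punctured_subsets_def I_def)
    show "0 \<le> Z n \<omega>" for n \<omega> unfolding Z_def by (rule sum_nonneg) (simp add: I_def)
  qed
  moreover have "AE \<omega> in M. simple_graph (G \<omega>) \<and> verts (G \<omega>) = {1..}"
    using G by (intro AE_I2) (simp add: infinite_ER_graph_def)
  ultimately show ?thesis
  proof eventually_elim
    case (elim \<omega>)
    have Z: "Z n \<omega> = real (nbr_cliques k (induced (G \<omega>) {1..n}) u)" if "u \<le> n" for n
    proof -
      have "Z n \<omega> = real (card (?\<Sigma> n \<inter> {S. P S \<subseteq> edges (G \<omega>)}))"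
        unfolding Z_def I_def by (simp only: sum_of_bool_eq finite_punctured_subsets)
      also have "?\<Sigma> n \<inter> {S. P S \<subseteq> edges (G \<omega>)} = {S \<in> ?\<Sigma> n. pairs_of (insert u S) \<subseteq> edges (G \<omega>)}"
        by (auto simp: P_def)
      also have "card \<dots> = nbr_cliques k (induced (G \<omega>) {1..n}) u"
        using elim that u by (intro nbr_cliques_induced[symmetric]) simp_all
      finally show ?thesis .
    qed
    have "\<forall>\<^sub>F n in sequentially.
        Z n \<omega> / real n ^ k = real (nbr_cliques k (induced (G \<omega>) {1..n}) u) / real n ^ k"
      using eventually_ge_at_top[of u] by eventually_elim (simp add: Z)
    with elim show ?case by (blast intro: Lim_transform_eventually)
  qed
qed

section \<open>The clustering coefficient of the tensor product\<close>

theorem theorem4p1: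
  fixes M :: "'w measure" and G H :: "'w \<Rightarrow> nat sgraph"
    and p :: real and k u v :: nat
  assumes "prob_space M"
    and "0 < p" and "p < 1"
    and "k \<ge> 1"
    and "infinite_ER_graph M p G"
    and "infinite_ER_graph M p H"
    and "indep_graphs M G H"
    and "u \<ge> 1" and "v \<ge> 1"
  shows "AE \<omega> in M.
    (\<lambda>n. clustering k (tensor (induced (G \<omega>) {1..n}) (induced (H \<omega>) {1..n})) (u, v))
      \<longlonglongrightarrow> p ^ (2 * (k choose 2))"
proof -
  interpret prob_space M by fact
  let ?G = "\<lambda>\<omega> n. induced (G \<omega>) {1..n}" and ?H = "\<lambda>\<omega> n. induced (H \<omega>) {1..n}"
  let ?q = "p ^ (Suc k choose 2)"
  have deg: "AE \<omega> in M. (\<lambda>n. real (degree (induced (F \<omega>) {1..n}) w) / real n) \<longlonglongrightarrow> p"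
    if "infinite_ER_graph M p F" "w \<ge> 1" for F :: "'w \<Rightarrow> nat sgraph" and w
    using AE_nbr_cliques_tendsto[OF that(1) assms(2,3) le_refl that(2)]
    by (simp add: nbr_cliques_1[unfolded One_nat_def] numeral_2_eq_2)
  have "AE \<omega> in M. simple_graph (G \<omega>)" "AE \<omega> in M. simple_graph (H \<omega>)"
    using assms(5,6) by (auto simp: infinite_ER_graph_def)
  with deg[OF assms(5,8)] deg[OF assms(6,9)]
    AE_nbr_cliques_tendsto[OF assms(5,2,3,4,8)] AE_nbr_cliques_tendsto[OF assms(6,2,3,4,9)]
  show ?thesis
  proof eventually_elim
    case (elim \<omega>)
    let ?dG = "\<lambda>n. degree (?G \<omega> n) u" and ?dH = "\<lambda>n. degree (?H \<omega> n) v"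
    let ?AG = "\<lambda>n. real (nbr_cliques k (?G \<omega> n) u)" and ?AH = "\<lambda>n. real (nbr_cliques k (?H \<omega> n) v)"
    let ?D = "\<lambda>n. real (?dG n * ?dH n choose k)"
    \<comment> \<open>The product degree grows like \<open>(p * n)\<^sup>2\<close>, so the natural
      scale for its binomial coefficient is \<open>((real n)\<^sup>2) ^ k\<close>.\<close>
    have "(\<lambda>n. real (?dG n) / real n * (real (?dH n) / real n)) \<longlonglongrightarrow> p * p"
      by (intro tendsto_mult elim)
    then have "(\<lambda>n. real (?dG n * ?dH n) / (real n)\<^sup>2) \<longlonglongrightarrow> p\<^sup>2"
      by (simp add: power2_eq_square)
    then have D: "(\<lambda>n. ?D n / ((real n)\<^sup>2) ^ k) \<longlonglongrightarrow> (p\<^sup>2) ^ k / fact k"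
      by (rule tendsto_binomial_div_power)
        (intro filterlim_pow_at_top filterlim_real_sequentially, simp)
    \<comment> \<open>Numerator and denominator are both scaled by \<open>n ^ (2 * k)\<close>. The
      limit of the denominator is nonzero because \<open>0 < p\<close>.\<close>
    have "(\<lambda>n. fact k * (?AG n / real n ^ k) * (?AH n / real n ^ k) / (?D n / ((real n)\<^sup>2) ^ k))
        \<longlonglongrightarrow> fact k * (?q / fact k) * (?q / fact k) / ((p\<^sup>2) ^ k / fact k)"
      by (intro tendsto_divide[OF _ D] tendsto_mult tendsto_const elim) (use assms(2) in simp)
    also have "fact k * (?q / fact k) * (?q / fact k) / ((p\<^sup>2) ^ k / fact k) = p ^ (2 * (k choose 2))"
    proof -
      \<comment> \<open>The \<open>k\<close> edges at each fixed vertex contribute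
        \<open>p ^ k\<close> per factor, which cancels against \<open>(p\<^sup>2) ^ k\<close> from
        the degrees; only the edges inside the cliques remain.\<close>
      have "?q = p ^ k * p ^ (k choose 2)"
        by (simp add: numeral_2_eq_2 power_add)
      then show ?thesis
        using assms(2) by (simp add: power_mult[symmetric] mult_2 power_add mult_2_right field_simps)
    qed
    finally show ?case
    proof (rule Lim_transform_eventually)
      show "\<forall>\<^sub>F n in sequentially.
          fact k * (?AG n / real n ^ k) * (?AH n / real n ^ k) / (?D n / ((real n)\<^sup>2) ^ k)
          = clustering k (tensor (?G \<omega> n) (?H \<omega> n)) (u, v)"
        \<comment> \<open>For \<open>n > 0\<close> the powers of \<open>n\<close> in numerator and
          denominator cancel.\<close>
        using eventually_gt_at_top[of 0]
      proof eventually_elim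
        case (elim n)
        have fin: "finite (nbrs (induced F {1..n}) w)" for F :: "nat sgraph" and w
          by (rule finite_subset[of _ "{1..n}"]) (auto simp: nbrs_def induced_def)
        have "nbr_cliques k (tensor (?G \<omega> n) (?H \<omega> n)) (u, v)
            = fact k * nbr_cliques k (?G \<omega> n) u * nbr_cliques k (?H \<omega> n) v"
          by (intro nbr_cliques_tensor simple_graph_induced fin)
            (use \<open>simple_graph (G \<omega>)\<close> \<open>simple_graph (H \<omega>)\<close> in auto)
        with elim show ?case
          by (simp add: clustering_def degree_tensor power2_eq_square power_mult_distrib)
      qed
    qed
  qed
qed

end
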